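(* Let $\omega$ be an environment, let $u_0$ be uniformly distributed on $[0,1)$, and let $u_n=\mathcal{U}_\omega^n(u_0)$, $n\ge0$. Then, for any $n\ge0$ and all $(x,y)\in\mathbb{Z}_+\times\mathbb{Z}_+$, $$P(u_n\in I_{(x,y)})=P_\omega(Z_n=(x,y)).$$ In particular, for any $n\ge 0$ and $x\in\mathbb{Z}_+$, $$P(u_n\in[x,x+1))=P_\omega(X_n=x).$$
   Context: $\mathbb{Z}_+=\{0,1,2,\dots\}$, $\mathbb{R}_+=[0,\infty)$. An environment is a family $\omega=(\omega^x)_{x\in\mathbb{Z}_+}$ of real sequences $\omega^x=(\omega^x_n)_{n\ge0}$ such that, for every $x$, $\omega^x_0=1$, $0<\omega^x_{n+1}<\omega^x_n$ for all $n\ge0$, and $\lim_{n\to\infty}\omega^x_n=0$. For each $x\in\mathbb{Z}_+$ the map $U_x:[0,1)\to[0,2)$ is defined by $U_x(0)=0$, $$U_x(u)=\frac{\omega^x_{n-1}-\omega^x_n}{\omega^x_n-\omega^x_{n+1}}(u-\omega^x_{n+1})+\omega^x_n,\quad u\in[\omega^x_{n+1},\omega^x_n),\ n\ge1,$$ $$U_x(u)=\frac{u-\omega^x_1}{1-\omega^x_1}+1,\quad u\in[\omega^x_1,1).$$ The global map $\mathcal{U}_\omega:\mathbb{R}_+\to\mathbb{R}_+$ is $\mathcal{U}_\omega(u)=\lfloor u\rfloor+U_{\lfloor u\rfloor}(u-\lfloor u\rfloor)$. For $x,y\in\mathbb{Z}_+$, $I_{(x,y)}=[x+\omega^x_{y+1},\,x+\omega^x_y)$.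 $Z_n=(X_n,Y_n)$, $n\ge0$, is the Markov chain on $\mathbb{Z}_+\times\mathbb{Z}_+$ with law $P_\omega$, initial distribution $P_\omega(Z_0=(0,y))=\omega^0_y-\omega^0_{y+1}$, $y\in\mathbb{Z}_+$, and transitions: from $(x',y')$ with $y'>0$ the chain moves to $(x',y'-1)$ with probability $1$; from $(x',0)$ it moves to $(x'+1,y)$ with probability $\omega^{x'+1}_y-\omega^{x'+1}_{y+1}$, $y\in\mathbb{Z}_+$. *)

theory Defs
  imports "HOL-Probability.Probability"
begin

definition environment :: "(nat \<Rightarrow> nat \<Rightarrow> real) \<Rightarrow> bool" where
  "environment \<omega> \<longleftrightarrow>
     (\<forall>x. \<omega> x 0 = 1 \<and> (\<forall>n. 0 < \<omega> x (n + 1) \<and> \<omega> x (n + 1) < \<omega> x n) \<and> \<omega> x \<longlonglongrightarrow> 0)"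

text \<open>Only the values on \<open>[0,1)\<close> are meaningful. In the last case \<open>n\<close> is the unique index
  with \<open>n \<ge> 1\<close> and \<open>u \<in> [\<omega> x (n + 1), \<omega> x n)\<close>; it exists for \<open>0 < u < \<omega> x 1\<close>.\<close>

definition local_map :: "(nat \<Rightarrow> nat \<Rightarrow> real) \<Rightarrow> nat \<Rightarrow> real \<Rightarrow> real" where
  "local_map \<omega> x u =
     (if u = 0 then 0
      else if u \<in> {\<omega> x 1..<1} then (u - \<omega> x 1) / (1 - \<omega> x 1) + 1
      else (let n = (THE n. n \<ge> 1 \<and> u \<in> {\<omega> x (n + 1)..<\<omega> x n})
            in (\<omega> x (n - 1) - \<omega> x n) / (\<omega> x n - \<omega> x (n + 1)) * (u - \<omega> x (n + 1)) + \<omega> x n))"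

text \<open>The half-line \<open>[0,\<infinity>)\<close> is represented inside type \<^typ>\<open>real\<close>; values at negative
  arguments are irrelevant.\<close>

definition global_map :: "(nat \<Rightarrow> nat \<Rightarrow> real) \<Rightarrow> real \<Rightarrow> real" where
  "global_map \<omega> u = of_int \<lfloor>u\<rfloor> + local_map \<omega> (nat \<lfloor>u\<rfloor>) (u - of_int \<lfloor>u\<rfloor>)"

definition cell :: "(nat \<Rightarrow> nat \<Rightarrow> real) \<Rightarrow> nat \<times> nat \<Rightarrow> real set" where
  "cell \<omega> = (\<lambda>(x, y). {real x + \<omega> x (y + 1)..<real x + \<omega> x y})"

definition init_prob :: "(nat \<Rightarrow> nat \<Rightarrow> real) \<Rightarrow> nat \<times> nat \<Rightarrow> real" where
  "init_prob \<omega> = (\<lambda>(x, y). if x = 0 then \<omega> 0 y - \<omega> 0 (y + 1) else 0)"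

definition trans_prob :: "(nat \<Rightarrow> nat \<Rightarrow> real) \<Rightarrow> nat \<times> nat \<Rightarrow> nat \<times> nat \<Rightarrow> real" where
  "trans_prob \<omega> = (\<lambda>(x', y') (x, y).
     if y' > 0 then (if (x, y) = (x', y' - 1) then 1 else 0)
     else (if x = x' + 1 then \<omega> (x' + 1) y - \<omega> (x' + 1) (y + 1) else 0))"

text \<open>A discrete-time Markov chain on a countable state space, with initial probabilities \<open>p0\<close>
  and transition probabilities \<open>p\<close>. The Markov property is required for all histories of positive
  probability.\<close>

definition markov_chain ::
  "'a measure \<Rightarrow> ('s::countable \<Rightarrow> real) \<Rightarrow> ('s \<Rightarrow> 's \<Rightarrow> real) \<Rightarrow> (nat \<Rightarrow> 'a \<Rightarrow> 's) \<Rightarrow> bool" where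
  "markov_chain M p0 p Z \<longleftrightarrow>
     prob_space M \<and>
     (\<forall>n. Z n \<in> measurable M (count_space UNIV)) \<and>
     (\<forall>s. \<P>(a in M. Z 0 a = s) = p0 s) \<and>
     (\<forall>n (s :: nat \<Rightarrow> 's) t.
        \<P>(a in M. \<forall>i\<le>n. Z i a = s i) > 0 \<longrightarrow>
        \<P>(a in M. Z (n + 1) a = t \<bar> \<forall>i\<le>n. Z i a = s i) = p (s n) t)"

end

theory Submission
  imports Defs
begin

text \<open>The global map sends the cell \<open>(x, y + 1)\<close> affinely onto the cell \<open>(x, y)\<close> and the cell
  \<open>(x, 0)\<close> affinely onto \<open>[x + 1, x + 2)\<close>, which is cut by the cells \<open>(x + 1, y)\<close> in the
  proportions of the transition probabilities. So the law of \<open>u\<^sub>n\<close> stays uniform on each cell, and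
  its cell masses obey the recursion of the one-step marginals of the chain. The cells omit the
  integers; since the marginals of the chain sum to 1, so do the cell masses, and the integers are
  null for the law of \<open>u\<^sub>n\<close>.\<close>

section \<open>Levels of an environment and the partition into cells\<close>

lemma environmentD:
  assumes "environment \<omega>"
  shows "\<omega> x 0 = 1" "0 < \<omega> x n" "\<omega> x (Suc n) < \<omega> x n" "\<omega> x \<longlonglongrightarrow> 0"
proof -
  show "0 < \<omega> x n"
    using assms by (cases n) (auto simp: environment_def)
qed (use assms in \<open>auto simp: environment_def\<close>)

lemma environment_antimono:
  assumes "environment \<omega>" "m \<le> n"
  shows "\<omega> x n \<le> \<omega> x m"
  by (rule lift_Suc_antimono_le[of "\<omega> x", OF less_imp_le[OF environmentD(3)[OF assms(1)]] assms(2)])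

lemma environment_le_1:
  assumes "environment \<omega>"
  shows "\<omega> x n \<le> 1"
  using environment_antimono[OF assms, of 0 n x] environmentD(1)[OF assms] by simp

lemma cell_iff: "v \<in> cell \<omega> (x, y) \<longleftrightarrow> v - real x \<in> {\<omega> x (Suc y)..<\<omega> x y}"
  by (auto simp: cell_def)

lemma level_unique:
  assumes "environment \<omega>" "w \<in> {\<omega> x (Suc m)..<\<omega> x m}" "w \<in> {\<omega> x (Suc n)..<\<omega> x n}"
  shows "m = n"
proof -
  have False if "m < n" "\<omega> x (Suc m) \<le> w" "w < \<omega> x n" for m n
    using environment_antimono[OF assms(1), of "Suc m" n x] that by simp
  with assms(2,3) show ?thesis
    by (meson atLeastLessThan_iff linorder_neqE_nat)
qed

text \<open>Since the levels tend to 0, some level lies at or below \<open>w\<close>, while level 0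
  equals 1 and lies above it. The first index whose level is at most \<open>w\<close> is therefore a
  successor \<open>Suc n\<close>.\<close>

lemma level_exists:
  assumes "environment \<omega>" "0 < w" "w < 1"
  shows "\<exists>n. w \<in> {\<omega> x (Suc n)..<\<omega> x n}"
proof -
  have "\<exists>n. \<omega> x n \<le> w"
    using order_tendstoD(2)[OF environmentD(4)[OF assms(1)] assms(2)]
    by (meson eventually_sequentially less_imp_le order_refl)
  then obtain n where "\<omega> x n \<le> w" ..
  moreover have "\<not> \<omega> x 0 \<le> w"
    using environmentD(1)[OF assms(1)] assms(3) by simp
  ultimately have "\<exists>k<n. (\<forall>i\<le>k. \<not> \<omega> x i \<le> w) \<and> \<omega> x (Suc k) \<le> w"
    by (rule ex_least_nat_less)
  then show ?thesis by (auto simp: not_le)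
qed

text \<open>Levels are at most 1, so a cell stays left of \<open>x + 1\<close>. The strict bound
  comes from positivity of the levels and keeps the integers out of all cells.\<close>

lemma floor_cell:
  assumes "environment \<omega>" "v \<in> cell \<omega> (x, y)"
  shows "\<lfloor>v\<rfloor> = int x" "real x < v"
  using assms environmentD(2)[OF assms(1), of x "Suc y"] environment_le_1[OF assms(1), of x y]
  by (auto simp: cell_iff floor_eq_iff)

lemma cell_unique:
  assumes "environment \<omega>" "v \<in> cell \<omega> s" "v \<in> cell \<omega> t"
  shows "s = t"
proof (cases s; cases t)
  fix x y x' y' assume s: "s = (x, y)" "t = (x', y')"
  then have "x = x'"
    using floor_cell(1)[OF assms(1), of v x y] floor_cell(1)[OF assms(1), of v x' y'] assms(2,3) by simp
  then show ?thesis
    using level_unique[OF assms(1)] assms(2,3) s by (auto simp: cell_iff)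
qed

text \<open>The fractional part of a nonnegative non-integer lies in \<open>(0,1)\<close> and so
  falls between two consecutive levels. The integers need a case of their own, as they belong to no
  cell.\<close>

lemma nonneg_cases:
  assumes "environment \<omega>" "0 \<le> v"
  obtains (int) x where "v = real x" | (cell) x y where "v \<in> cell \<omega> (x, y)"
proof (cases "v = real (nat \<lfloor>v\<rfloor>)")
  case False
  let ?x = "nat \<lfloor>v\<rfloor>"
  have "0 < v - real ?x" "v - real ?x < 1"
    using assms(2) False by (simp_all add: of_nat_nat) linarith+
  from level_exists[OF assms(1) this] obtain y where "v \<in> cell \<omega> (?x, y)"
    by (auto simp: cell_iff)
  then show ?thesis by (rule cell)
qed (rule int)

section \<open>The global map on integers and cells\<close>

lemma global_map_of_nat: "global_map \<omega> (real x) = real x"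
  by (simp add: global_map_def local_map_def)

text \<open>The shape is slope times distance from the left end of the source, plus the left end of
  the target, as \<open>rescale_interval\<close> expects.\<close>

lemma global_map_cell_0:
  assumes "environment \<omega>" "v \<in> cell \<omega> (x, 0)"
  shows "global_map \<omega> v = 1 / (1 - \<omega> x 1) * (v - (real x + \<omega> x 1)) + (real x + 1)"
  using floor_cell[OF assms] assms(2) environmentD(1)[OF assms(1), of x]
  by (simp add: global_map_def local_map_def cell_iff diff_diff_eq)

lemma global_map_cell_Suc:
  assumes "environment \<omega>" "v \<in> cell \<omega> (x, Suc y)"
  shows "global_map \<omega> v =
    (\<omega> x y - \<omega> x (Suc y)) / (\<omega> x (Suc y) - \<omega> x (Suc (Suc y))) * (v - (real x + \<omega> x (Suc (Suc y))))
      + (real x + \<omega> x (Suc y))"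
proof -
  have w: "v - real x \<in> {\<omega> x (Suc (Suc y))..<\<omega> x (Suc y)}"
    using assms(2) by (simp add: cell_iff)
  have "(THE n. n \<ge> 1 \<and> v - real x \<in> {\<omega> x (n + 1)..<\<omega> x n}) = Suc y"
  proof (rule the_equality)
    fix n assume "1 \<le> n \<and> v - real x \<in> {\<omega> x (n + 1)..<\<omega> x n}"
    then show "n = Suc y"
      using level_unique[OF assms(1) w, of n] by simp
  qed (use w in simp)
  \<comment> \<open>Together with \<open>real x < v\<close> this excludes the first two branches of
    \<open>local_map\<close>.\<close>
  moreover have "v - real x < \<omega> x 1"
    using w environment_antimono[OF assms(1), of 1 "Suc y" x] by simp
  ultimately show ?thesis
    using floor_cell[OF assms]
    by (simp add: global_map_def local_map_def diff_diff_eq)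
qed

lemma affine_in_interval_iff:
  fixes s :: real
  assumes "s > 0"
  shows "s * (v - c) + e \<in> {a..<b} \<longleftrightarrow> v \<in> {c + (a - e) / s..<c + (b - e) / s}"
  using assms by (auto simp: field_simps)

text \<open>This keeps orbits in the half-line, where \<open>nonneg_cases\<close> applies.\<close>

lemma global_map_nonneg:
  assumes "environment \<omega>" "0 \<le> v"
  shows "0 \<le> global_map \<omega> v"
  using assms
proof (cases rule: nonneg_cases)
  case (int x)
  then show ?thesis by (simp add: global_map_of_nat)
next
  case (cell x y)
  show ?thesis
  proof (cases y)
    case 0
    then show ?thesis
      using cell global_map_cell_0[OF assms(1), of v x] environment_le_1[OF assms(1), of x 1]
      by (auto simp: cell_iff)
  next
    case (Suc z)
    have "0 \<le> (\<omega> x z - \<omega> x (Suc z)) / (\<omega> x (Suc z) - \<omega> x (Suc (Suc z)))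
        * (v - (real x + \<omega> x (Suc (Suc z))))"
      using environmentD(3)[OF assms(1)] cell Suc
      by (intro mult_nonneg_nonneg divide_nonneg_nonneg) (auto simp: cell_iff less_imp_le)
    then show ?thesis
      using cell Suc global_map_cell_Suc[OF assms(1), of v x z] environmentD(2)[OF assms(1), of x y]
      by simp
  qed
qed

section \<open>Measurability of the maps\<close>

lemma borel_measurable_local_map:
  assumes "environment \<omega>"
  shows "local_map \<omega> x \<in> borel_measurable borel"
proof -
  \<comment> \<open>The index is a measurable function of \<open>u\<close>: each defining condition
    is measurable, and at most one index satisfies it.\<close>
  have [measurable]: "(\<lambda>u. THE n. n \<ge> 1 \<and> u \<in> {\<omega> x (n + 1)..<\<omega> x n}) \<in> measurable borel (count_space UNIV)"
  proof (rule measurable_THE)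
    fix i j u
    assume "1 \<le> i \<and> u \<in> {\<omega> x (i + 1)..<\<omega> x i}" "1 \<le> j \<and> u \<in> {\<omega> x (j + 1)..<\<omega> x j}"
    then show "i = j" using level_unique[OF assms, of u x i j] by simp
  qed auto
  show ?thesis
    unfolding local_map_def Let_def by measurable
qed

lemma borel_measurable_global_map:
  assumes "environment \<omega>"
  shows "global_map \<omega> \<in> borel_measurable borel"
proof -
  have "(\<lambda>u. local_map \<omega> (nat \<lfloor>u\<rfloor>) (u - of_int \<lfloor>u\<rfloor>)) \<in> borel_measurable borel"
  \<comment> \<open>The environment at \<open>x\<close> selects the branch, and \<open>x\<close>
    takes only countably many values.\<close>
  proof (rule measurable_compose_countable[where g = "\<lambda>u. nat \<lfloor>u\<rfloor>"])
    show "(\<lambda>u. local_map \<omega> x (u - of_int \<lfloor>u\<rfloor>)) \<in> borel_measurable borel" for x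
      by (rule measurable_compose[OF _ borel_measurable_local_map[OF assms]]) measurable
  qed measurable
  moreover have "(\<lambda>u::real. real_of_int \<lfloor>u\<rfloor>) \<in> borel_measurable borel"
    by measurable
  ultimately show ?thesis
    unfolding global_map_def[abs_def] by (intro borel_measurable_add)
qed

section \<open>One-step marginals of a Markov chain\<close>

lemma (in prob_space) prob_sums_countable:
  fixes g :: "'a \<Rightarrow> 's::countable"
  assumes [measurable]: "g \<in> measurable M (count_space UNIV)" "Measurable.pred M Q"
  shows "(\<lambda>k. \<P>(a in M. Q a \<and> to_nat (g a) = k)) sums \<P>(a in M. Q a)"
proof -
  have "(\<lambda>k. prob {a \<in> space M. Q a \<and> to_nat (g a) = k}) sums prob (\<Union>k. {a \<in> space M. Q a \<and> to_nat (g a) = k})"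
    by (rule finite_measure_UNION) (auto simp: disjoint_family_on_def)
  also have "(\<Union>k. {a \<in> space M. Q a \<and> to_nat (g a) = k}) = {a \<in> space M. Q a}"
    by auto
  finally show ?thesis .
qed

text \<open>The definition speaks only about complete histories of positive probability. The product
  form remains valid when the event \<open>Z n a = s\<close> is null.\<close>

lemma markov_chain_joint_prob:
  assumes mc: "markov_chain N p0 p Z"
  shows "\<P>(a in N. Z (Suc n) a = t \<and> Z n a = s) = \<P>(a in N. Z n a = s) * p s t"
proof -
  interpret prob_space N using mc by (simp add: markov_chain_def)
  have Z [measurable]: "Z n \<in> measurable N (count_space UNIV)" for n
    using mc by (simp add: markov_chain_def)
  \<comment> \<open>Countably many histories \<open>h\<close>: summing over them reduces the Markov property to one step.\<close>
  define h where "h a = map (\<lambda>i. Z i a) [0..<Suc n]" for a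
  have h_eq: "h a = l \<longleftrightarrow> length l = Suc n \<and> (\<forall>i\<le>n. Z i a = l ! i)" for a l
    unfolding h_def by (auto simp: list_eq_iff_nth_eq less_Suc_eq_le simp del: upt_Suc)
  have h [measurable]: "h \<in> measurable N (count_space UNIV)"
    by (subst measurable_count_space_eq2_countable) (auto simp: vimage_def h_eq Int_def conj_commute)
  have "\<P>(a in N. (Z (Suc n) a = t \<and> Z n a = s) \<and> to_nat (h a) = k)
      = \<P>(a in N. Z n a = s \<and> to_nat (h a) = k) * p s t" for k
  \<comment> \<open>Either \<open>k\<close> encodes a history of the right length that ends in
    \<open>s\<close>, or both events are empty.\<close>
  proof (cases "\<exists>l. k = to_nat l \<and> length l = Suc n \<and> l ! n = s")
    case True
    then obtain l where l: "k = to_nat l" "length l = Suc n" "l ! n = s" by auto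
    have 1: "Z n a = s \<and> to_nat (h a) = k \<longleftrightarrow> (\<forall>i\<le>n. Z i a = l ! i)" for a
      using l by (auto simp: h_eq)
    have 2: "(Z (Suc n) a = t \<and> Z n a = s) \<and> to_nat (h a) = k \<longleftrightarrow>
        Z (n + 1) a = t \<and> (\<forall>i\<le>n. Z i a = l ! i)" for a
      using 1[of a] by auto
    show ?thesis
    proof (cases "\<P>(a in N. \<forall>i\<le>n. Z i a = l ! i) > 0")
      case True
      then have "\<P>(a in N. Z (n + 1) a = t \<bar> \<forall>i\<le>n. Z i a = l ! i) = p s t"
        using mc l(3) by (auto simp: markov_chain_def)
      with True show ?thesis
        unfolding 1 2 cond_prob_def by (simp add: field_simps)
    next
      case False
      then have 0: "\<P>(a in N. \<forall>i\<le>n. Z i a = l ! i) = 0"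
        by (simp add: zero_less_measure_iff)
      \<comment> \<open>After a null history the Markov property is silent, but both sides vanish by
        monotonicity.\<close>
      have "\<P>(a in N. Z (n + 1) a = t \<and> (\<forall>i\<le>n. Z i a = l ! i)) \<le> \<P>(a in N. \<forall>i\<le>n. Z i a = l ! i)"
        by (intro finite_measure_mono) auto
      with 0 show ?thesis
        unfolding 1 2 by (simp add: measure_le_0_iff)
    qed
  next
    case False
    then have "\<not> (Z n a = s \<and> to_nat (h a) = k)" for a
      using h_eq[of a "h a"] by (metis le_refl)
    then have "{a \<in> space N. (Z (Suc n) a = t \<and> Z n a = s) \<and> to_nat (h a) = k} = {}"
      "{a \<in> space N. Z n a = s \<and> to_nat (h a) = k} = {}" by blast+
    then show ?thesis by (simp only: measure_empty mult_zero_left)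
  qed
  then have "(\<lambda>k. \<P>(a in N. Z n a = s \<and> to_nat (h a) = k) * p s t)
      sums \<P>(a in N. Z (Suc n) a = t \<and> Z n a = s)"
    using prob_sums_countable[OF h, of "\<lambda>a. Z (Suc n) a = t \<and> Z n a = s"] by simp
  moreover have "(\<lambda>k. \<P>(a in N. Z n a = s \<and> to_nat (h a) = k) * p s t)
      sums (\<P>(a in N. Z n a = s) * p s t)"
    by (intro sums_mult2 prob_sums_countable) auto
  ultimately show ?thesis by (rule sums_unique2)
qed

text \<open>Total probability over the state at time \<open>n\<close>; a finite set of predecessors
  makes the series a finite sum. In the application a state has at most two predecessors.\<close>

lemma markov_chain_step:
  assumes mc: "markov_chain N p0 p Z" and S: "finite S" "\<And>s. s \<notin> S \<Longrightarrow> p s t = 0"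
  shows "\<P>(a in N. Z (Suc n) a = t) = (\<Sum>s\<in>S. \<P>(a in N. Z n a = s) * p s t)"
proof -
  interpret prob_space N using mc by (simp add: markov_chain_def)
  have Z [measurable]: "Z n \<in> measurable N (count_space UNIV)" for n
    using mc by (simp add: markov_chain_def)
  have joint: "\<P>(a in N. Z (Suc n) a = t \<and> to_nat (Z n a) = to_nat s) = \<P>(a in N. Z n a = s) * p s t" for s
    using markov_chain_joint_prob[OF mc] by simp
  have "(\<lambda>k. \<P>(a in N. Z (Suc n) a = t \<and> to_nat (Z n a) = k)) sums \<P>(a in N. Z (Suc n) a = t)"
    by (rule prob_sums_countable) auto
  moreover have "(\<lambda>k. \<P>(a in N. Z (Suc n) a = t \<and> to_nat (Z n a) = k)) sums
      (\<Sum>k\<in>to_nat ` S. \<P>(a in N. Z (Suc n) a = t \<and> to_nat (Z n a) = k))"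
  proof (rule sums_finite)
    fix k assume k: "k \<notin> to_nat ` S"
    show "\<P>(a in N. Z (Suc n) a = t \<and> to_nat (Z n a) = k) = 0"
    proof (cases "\<exists>s. k = to_nat (s :: 'b)")
      case True
      then obtain s :: 'b where "k = to_nat s" by auto
      then show ?thesis using k S(2)[of s] joint by auto
    next
      \<comment> \<open>\<open>to_nat\<close> need not be surjective; numbers that encode no state
        contribute the empty event.\<close>
      case False
      then have "{a \<in> space N. Z (Suc n) a = t \<and> to_nat (Z n a) = k} = {}" by auto
      then show ?thesis by (simp only: measure_empty)
    qed
  qed (use S in simp)
  ultimately have "\<P>(a in N. Z (Suc n) a = t) =
      (\<Sum>k\<in>to_nat ` S. \<P>(a in N. Z (Suc n) a = t \<and> to_nat (Z n a) = k))"
    by (rule sums_unique2)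
  also have "\<dots> = (\<Sum>s\<in>S. \<P>(a in N. Z (Suc n) a = t \<and> to_nat (Z n a) = to_nat s))"
    by (subst sum.reindex) (auto intro: inj_onI)
  also have "\<dots> = (\<Sum>s\<in>S. \<P>(a in N. Z n a = s) * p s t)"
    by (intro sum.cong refl joint)
  finally show ?thesis .
qed

section \<open>Preimages of intervals under the affine branches\<close>

text \<open>The affine map carries \<open>[c,d)\<close> onto \<open>[e,f)\<close>, and pulling an
  interval back along it preserves its length relative to the ambient interval. This is how
  uniformity on cells is propagated.\<close>

lemma rescale_interval:
  fixes a b c d e f s :: real
  assumes "c < d" "e < f" "s = (f - e) / (d - c)" "e \<le> a" "a \<le> b" "b \<le> f"
  shows "\<exists>a' b'. c \<le> a' \<and> a' \<le> b' \<and> b' \<le> d \<and> (b' - a') / (d - c) = (b - a) / (f - e) \<and>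
    (\<forall>v. s * (v - c) + e \<in> {a..<b} \<longleftrightarrow> v \<in> {a'..<b'})"
proof (intro exI conjI allI)
  have s: "s > 0" using assms by simp
  show "c \<le> c + (a - e) / s" "c + (a - e) / s \<le> c + (b - e) / s"
    using s assms by (auto simp: divide_right_mono)
  have "(b - e) / s \<le> (f - e) / s"
    using s assms by (intro divide_right_mono) auto
  also have "\<dots> = d - c"
    using assms by simp
  finally show "c + (b - e) / s \<le> d" by simp
  have "(c + (b - e) / s - (c + (a - e) / s)) = (b - a) / s"
    by (simp add: diff_divide_distrib)
  moreover have "s * (d - c) = f - e"
    using assms by simp
  ultimately show "(c + (b - e) / s - (c + (a - e) / s)) / (d - c) = (b - a) / (f - e)"
    by (simp only: divide_divide_eq_left)
qed (rule affine_in_interval_iff, use assms in simp)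

lemma global_map_preimage_Suc:
  assumes "environment \<omega>" "real x + \<omega> x (Suc y) \<le> a" "a \<le> b" "b \<le> real x + \<omega> x y"
  obtains a' b' where "real x + \<omega> x (Suc (Suc y)) \<le> a'" "a' \<le> b'" "b' \<le> real x + \<omega> x (Suc y)"
    "(b' - a') / (\<omega> x (Suc y) - \<omega> x (Suc (Suc y))) = (b - a) / (\<omega> x y - \<omega> x (Suc y))"
    "\<And>v. v \<in> cell \<omega> (x, Suc y) \<Longrightarrow> global_map \<omega> v \<in> {a..<b} \<longleftrightarrow> v \<in> {a'..<b'}"
proof -
  have "\<exists>a' b'. real x + \<omega> x (Suc (Suc y)) \<le> a' \<and> a' \<le> b' \<and> b' \<le> real x + \<omega> x (Suc y) \<and>
    (b' - a') / ((real x + \<omega> x (Suc y)) - (real x + \<omega> x (Suc (Suc y)))) =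
      (b - a) / ((real x + \<omega> x y) - (real x + \<omega> x (Suc y))) \<and>
    (\<forall>v. (\<omega> x y - \<omega> x (Suc y)) / (\<omega> x (Suc y) - \<omega> x (Suc (Suc y))) * (v - (real x + \<omega> x (Suc (Suc y))))
      + (real x + \<omega> x (Suc y)) \<in> {a..<b} \<longleftrightarrow> v \<in> {a'..<b'})"
    by (rule rescale_interval) (use assms environmentD(3)[OF assms(1)] in auto)
  then show thesis
    using that global_map_cell_Suc[OF assms(1)] by (auto simp del: atLeastLessThan_iff)
qed

text \<open>The target here is all of \<open>[x + 1, x + 2)\<close>, of length 1, so the relative
  length on the right is just \<open>b - a\<close>.\<close>

lemma global_map_preimage_0:
  assumes "environment \<omega>" "real x + 1 \<le> a" "a \<le> b" "b \<le> real x + 2"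
  obtains a' b' where "real x + \<omega> x 1 \<le> a'" "a' \<le> b'" "b' \<le> real x + 1"
    "(b' - a') / (1 - \<omega> x 1) = b - a"
    "\<And>v. v \<in> cell \<omega> (x, 0) \<Longrightarrow> global_map \<omega> v \<in> {a..<b} \<longleftrightarrow> v \<in> {a'..<b'}"
proof -
  have "\<exists>a' b'. real x + \<omega> x 1 \<le> a' \<and> a' \<le> b' \<and> b' \<le> real x + 1 \<and>
    (b' - a') / ((real x + 1) - (real x + \<omega> x 1)) = (b - a) / ((real x + 2) - (real x + 1)) \<and>
    (\<forall>v. 1 / (1 - \<omega> x 1) * (v - (real x + \<omega> x 1)) + (real x + 1) \<in> {a..<b} \<longleftrightarrow> v \<in> {a'..<b'})"
    by (rule rescale_interval)
      (use assms environmentD(1)[OF assms(1), of x] environmentD(3)[OF assms(1), of x 0] in auto)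
  then show thesis
    using that global_map_cell_0[OF assms(1)] by (auto simp del: atLeastLessThan_iff)
qed

lemma interval_subset_cell:
  assumes "real x + \<omega> x (Suc y) \<le> a" "b \<le> real x + \<omega> x y" "v \<in> {a..<b}"
  shows "v \<in> cell \<omega> (x, y)"
  using assms by (auto simp: cell_def)

text \<open>These are exactly the predecessors allowed by the chain. Integers drop out because they
  are fixed points outside every cell; any other point lies in a cell whose image is known.\<close>

lemma global_map_cell_imp:
  assumes "environment \<omega>" "0 \<le> v" "global_map \<omega> v \<in> cell \<omega> (x, y)"
  shows "v \<in> cell \<omega> (x, Suc y) \<or> (\<exists>z. x = Suc z \<and> v \<in> cell \<omega> (z, 0))"
  using assms(1,2)
proof (cases rule: nonneg_cases)
  case (int z)
  then show ?thesis
    using floor_cell[OF assms(1,3)] by (simp add: global_map_of_nat)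
next
  case (cell x' y')
  show ?thesis
  proof (cases y')
    case 0
    have w: "\<omega> x' 1 < 1" "v - (real x' + \<omega> x' 1) \<ge> 0" "v - (real x' + \<omega> x' 1) < 1 - \<omega> x' 1"
      using cell 0 environmentD(1)[OF assms(1), of x'] environmentD(3)[OF assms(1), of x' 0]
      by (auto simp: cell_iff)
    then have "\<lfloor>global_map \<omega> v\<rfloor> = int (Suc x')"
      using global_map_cell_0[OF assms(1), of v x'] cell 0
      by (simp add: floor_eq_iff)
    then show ?thesis
      using floor_cell(1)[OF assms(1,3)] cell 0 by auto
  next
    case (Suc n)
    let ?r = "\<omega> x' (Suc n) - \<omega> x' (Suc (Suc n))"
    have pos: "?r > 0" "\<omega> x' n - \<omega> x' (Suc n) > 0"
      using environmentD(3)[OF assms(1)] by auto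
    have w: "0 \<le> v - (real x' + \<omega> x' (Suc (Suc n)))" "v - (real x' + \<omega> x' (Suc (Suc n))) < ?r"
      using cell Suc by (auto simp: cell_iff)
    have "(\<omega> x' n - \<omega> x' (Suc n)) / ?r * (v - (real x' + \<omega> x' (Suc (Suc n))))
        < (\<omega> x' n - \<omega> x' (Suc n)) / ?r * ?r"
      using pos w by (intro mult_strict_left_mono) auto
    moreover have "0 \<le> (\<omega> x' n - \<omega> x' (Suc n)) / ?r * (v - (real x' + \<omega> x' (Suc (Suc n))))"
      using pos w by (intro mult_nonneg_nonneg) auto
    ultimately have "global_map \<omega> v \<in> cell \<omega> (x', n)"
      using global_map_cell_Suc[OF assms(1), of v x' n] cell Suc pos by (simp add: cell_iff)
    from cell_unique[OF assms(1,3) this] show ?thesis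
      using cell Suc by simp
  qed
qed

section \<open>The law of \<open>u n\<close> inside a cell\<close>

text \<open>Subintervals are required for the induction on \<open>n\<close>: the preimage of a cell
  \<open>(Suc z, y)\<close> inside \<open>(z, 0)\<close> is only a part of that cell, so masses of
  whole cells would not determine the next step.\<close>

lemma interval_prob:
  fixes M :: "'a measure" and u :: "nat \<Rightarrow> 'a \<Rightarrow> real"
  assumes env: "environment \<omega>"
    and M: "prob_space M"
    and u0: "u 0 \<in> borel_measurable M"
    and unif: "distr M borel (u 0) = uniform_measure lborel {0..<1}"
    and u: "\<And>n a. u (Suc n) a = global_map \<omega> (u n a)"
    and mc: "markov_chain N (init_prob \<omega>) (trans_prob \<omega>) Z"
    and ab: "real x + \<omega> x (Suc y) \<le> a" "a \<le> b" "b \<le> real x + \<omega> x y"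
  shows "\<P>(w in M. u n w \<in> {a..<b}) =
    \<P>(w in N. Z n w = (x, y)) * ((b - a) / (\<omega> x y - \<omega> x (Suc y)))"
proof -
  interpret prob_space M by fact
  have um [measurable]: "u n \<in> borel_measurable M" for n
    using u0 measurable_compose[OF _ borel_measurable_global_map[OF env]]
    by (induction n) (auto simp: u[abs_def])
  have distr0: "measure M {w \<in> space M. u 0 w \<in> A} = measure lborel ({0..<1} \<inter> A)" if "A \<in> sets borel" for A
  proof -
    have "measure M {w \<in> space M. u 0 w \<in> A} = measure (distr M borel (u 0)) A"
      using that by (simp add: measure_distr u0 vimage_def Int_def conj_commute)
    then show ?thesis
      using that by (simp add: unif measure_uniform_measure)
  qed
  show ?thesis
    using ab
  proof (induction n arbitrary: x y a b)
    case 0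
    have Z0: "\<P>(w in N. Z 0 w = (x, y)) = init_prob \<omega> (x, y)"
      using mc by (simp add: markov_chain_def)
    have lt: "\<omega> x (Suc y) < \<omega> x y" using environmentD(3)[OF env] .
    have "\<omega> x (Suc y) > 0" "\<omega> x y \<le> 1"
      using environmentD(2)[OF env] environment_le_1[OF env] by auto
    \<comment> \<open>Only cells with \<open>x = 0\<close> meet the support of the initial
      law.\<close>
    then have *: "{0..<1} \<inter> {a..<b} = (if x = 0 then {a..<b} else {})"
      using 0 by auto
    show ?case
      using lt 0 unfolding distr0[of "{a..<b}", OF atLeastLessThan_borel] * Z0
      by (cases "x = 0") (simp_all add: init_prob_def)
  next
    case (Suc n)
    \<comment> \<open>Only the distribution of \<open>u 0\<close> is prescribed, so nonnegativity
      holds merely almost everywhere.\<close>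
    have nonneg: "AE w in M. 0 \<le> u n w"
    proof -
      have "AE v in distr M borel (u 0). 0 \<le> v"
        unfolding unif by (rule AE_uniform_measureI) auto
      then have "AE w in M. 0 \<le> u 0 w"
        by (subst (asm) AE_distr_iff) auto
      moreover have "0 \<le> u n w" if "0 \<le> u 0 w" for w
        using that by (induction n) (auto simp: u global_map_nonneg[OF env])
      ultimately show ?thesis by auto
    qed
    let ?q = "\<lambda>x y. \<P>(w in N. Z n w = (x, y))" and ?l = "(b - a) / (\<omega> x y - \<omega> x (Suc y))"
    obtain a1 b1 where 1: "real x + \<omega> x (Suc (Suc y)) \<le> a1" "a1 \<le> b1" "b1 \<le> real x + \<omega> x (Suc y)"
      "(b1 - a1) / (\<omega> x (Suc y) - \<omega> x (Suc (Suc y))) = ?l"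
      "\<And>v. v \<in> cell \<omega> (x, Suc y) \<Longrightarrow> global_map \<omega> v \<in> {a..<b} \<longleftrightarrow> v \<in> {a1..<b1}"
      using global_map_preimage_Suc[OF env Suc.prems] by metis
    have sub0: "v \<in> {a..<b} \<Longrightarrow> v \<in> cell \<omega> (x, y)" for v
      using interval_subset_cell[of x \<omega> y a b v] Suc.prems by blast
    have sub1: "v \<in> {a1..<b1} \<Longrightarrow> v \<in> cell \<omega> (x, Suc y)" for v
      using interval_subset_cell[of x \<omega> "Suc y" a1 b1 v] 1 by blast
    have P1: "\<P>(w in M. u n w \<in> {a1..<b1}) = ?q x (Suc y) * ?l"
      using Suc.IH[OF 1(1-3)] 1(4) by simp
    show ?case
    proof (cases x)
      case 0
      \<comment> \<open>In the first column \<open>(x, Suc y)\<close> is the only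
        predecessor.\<close>
      have iff: "global_map \<omega> v \<in> {a..<b} \<longleftrightarrow> v \<in> {a1..<b1}" if "0 \<le> v" for v
        using 1(5)[of v] sub1[of v] global_map_cell_imp[OF env that, of x y]
          sub0[of "global_map \<omega> v"] 0 by blast
      have "\<P>(w in M. u (Suc n) w \<in> {a..<b}) = \<P>(w in M. u n w \<in> {a1..<b1})"
      proof (rule prob_eq_AE)
        show "AE w in M. u (Suc n) w \<in> {a..<b} \<longleftrightarrow> u n w \<in> {a1..<b1}"
          using nonneg by eventually_elim (simp only: u iff)
      qed measurable
      moreover have "\<P>(w in N. Z (Suc n) w = (x, y)) = ?q x (Suc y)"
        by (subst markov_chain_step[OF mc, of "{(x, Suc y)}"]) (use 0 in \<open>auto simp: trans_prob_def split: if_splits\<close>)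
      ultimately show ?thesis using P1 by simp
    next
      case (Suc z)
      have lt1: "real z + 1 \<le> a" "b \<le> real z + 2"
        using Suc.prems Suc environmentD(2)[OF env, of x "Suc y"] environment_le_1[OF env, of x y] by auto
      obtain a2 b2 where 2: "real z + \<omega> z 1 \<le> a2" "a2 \<le> b2" "b2 \<le> real z + 1"
        "(b2 - a2) / (1 - \<omega> z 1) = b - a"
        "\<And>v. v \<in> cell \<omega> (z, 0) \<Longrightarrow> global_map \<omega> v \<in> {a..<b} \<longleftrightarrow> v \<in> {a2..<b2}"
        using global_map_preimage_0[OF env lt1(1) Suc.prems(2) lt1(2)] by metis
      have bnd2: "real z + \<omega> z (Suc 0) \<le> a2" "b2 \<le> real z + \<omega> z 0"
        using 2 environmentD(1)[OF env] by auto
      have sub2: "v \<in> {a2..<b2} \<Longrightarrow> v \<in> cell \<omega> (z, 0)" for v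
        using interval_subset_cell[of z \<omega> 0 a2 b2 v] bnd2 by blast
      have P2: "\<P>(w in M. u n w \<in> {a2..<b2}) = ?q z 0 * (b - a)"
        using Suc.IH[OF bnd2(1) 2(2) bnd2(2)] 2(4) environmentD(1)[OF env, of z] by (simp flip: times_divide_eq_right)
      have iff: "global_map \<omega> v \<in> {a..<b} \<longleftrightarrow> v \<in> {a1..<b1} \<or> v \<in> {a2..<b2}" if "0 \<le> v" for v
        using 1(5)[of v] sub1[of v] 2(5)[of v] sub2[of v]
          global_map_cell_imp[OF env that, of x y]
          sub0[of "global_map \<omega> v"] Suc by blast
      have disj: "\<not> (v \<in> {a1..<b1} \<and> v \<in> {a2..<b2})" for v
        using sub1[of v] sub2[of v]
          cell_unique[OF env, of v "(x, Suc y)" "(z, 0)"] by blast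
      have "\<P>(w in M. u (Suc n) w \<in> {a..<b}) = \<P>(w in M. u n w \<in> {a1..<b1} \<or> u n w \<in> {a2..<b2})"
      proof (rule prob_eq_AE)
        show "AE w in M. u (Suc n) w \<in> {a..<b} \<longleftrightarrow> u n w \<in> {a1..<b1} \<or> u n w \<in> {a2..<b2}"
          using nonneg by eventually_elim (simp only: u iff)
      qed measurable
      also have "\<dots> = measure M ({w \<in> space M. u n w \<in> {a1..<b1}} \<union> {w \<in> space M. u n w \<in> {a2..<b2}})"
        by (rule arg_cong[where f = "measure M"]) blast
      also have "\<dots> = \<P>(w in M. u n w \<in> {a1..<b1}) + \<P>(w in M. u n w \<in> {a2..<b2})"
        using disj by (intro finite_measure_Union) (measurable, blast)
      also have "\<dots> = ?q x (Suc y) * ?l + ?q z 0 * (b - a)"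
        using P1 P2 by simp
      \<comment> \<open>Writing \<open>b - a\<close> as the cell length times \<open>?l\<close>
        brings out the transition probability from \<open>(z, 0)\<close> to
        \<open>(x, y)\<close>.\<close>
      also have "\<dots> = (?q x (Suc y) + ?q z 0 * (\<omega> x y - \<omega> x (Suc y))) * ?l"
        using environmentD(3)[OF env, of x y] by (simp add: field_simps)
      also have "?q x (Suc y) + ?q z 0 * (\<omega> x y - \<omega> x (Suc y)) = \<P>(w in N. Z (Suc n) w = (x, y))"
        by (subst markov_chain_step[OF mc, of "{(x, Suc y), (z, 0)}"])
          (use Suc in \<open>auto simp: trans_prob_def split: if_splits\<close>)
      finally show ?thesis .
    qed
  qed
qed

section \<open>Passage from single cells to unit intervals\<close>

theorem proposition1p3:
  fixes \<omega> :: "nat \<Rightarrow> nat \<Rightarrow> real"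
    and M :: "'a measure" and u :: "nat \<Rightarrow> 'a \<Rightarrow> real"
    and N :: "'b measure" and Z :: "nat \<Rightarrow> 'b \<Rightarrow> nat \<times> nat"
  assumes "environment \<omega>"
    and "prob_space M"
    and "u 0 \<in> borel_measurable M"
    and "distr M borel (u 0) = uniform_measure lborel {0..<1}"
    and "\<And>n a. u n a = (global_map \<omega> ^^ n) (u 0 a)"
    and "markov_chain N (init_prob \<omega>) (trans_prob \<omega>) Z"
  shows "(\<forall>n x y. \<P>(a in M. u n a \<in> cell \<omega> (x, y)) = \<P>(b in N. Z n b = (x, y))) \<and>
         (\<forall>n x. \<P>(a in M. u n a \<in> {real x..<real x + 1}) = \<P>(b in N. fst (Z n b) = x))"
proof -
  interpret M: prob_space M by fact
  interpret N: prob_space N using assms(6) by (simp add: markov_chain_def)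
  have Z [measurable]: "Z n \<in> measurable N (count_space UNIV)" for n
    using assms(6) by (simp add: markov_chain_def)
  have u_Suc: "u (Suc n) a = global_map \<omega> (u n a)" for n a
    using assms(5)[of "Suc n" a] assms(5)[of n a] by simp
  have um [measurable]: "u n \<in> borel_measurable M" for n
    using assms(3) measurable_compose[OF _ borel_measurable_global_map[OF assms(1)]]
    by (induction n) (auto simp: u_Suc[abs_def])
  have cell_prob: "\<P>(a in M. u n a \<in> cell \<omega> s) = \<P>(b in N. Z n b = s)" for n s
  proof (cases s)
    case (Pair x y)
    show ?thesis
      \<comment> \<open>For the whole cell the relative length is 1.\<close>
      using interval_prob[where u = u, OF assms(1-4) u_Suc assms(6), of x y "real x + \<omega> x (Suc y)" "real x + \<omega> x y" n]
        environmentD(3)[OF assms(1), of x y] Pair by (simp add: cell_def)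
  qed
  have cell_borel [measurable]: "cell \<omega> s \<in> sets borel" for s
    by (cases s) (simp add: cell_def)
  \<comment> \<open>Countable additivity over the disjoint cells, enumerated by
    \<open>to_nat\<close>. Taking \<open>Q\<close> constantly true gives total mass 1;
    \<open>fst s = x\<close> selects a column.\<close>
  have union: "\<P>(a in M. \<exists>s. Q s \<and> u n a \<in> cell \<omega> s) = \<P>(b in N. Q (Z n b))" for n Q
  proof -
    let ?A = "\<lambda>k. {a \<in> space M. \<exists>s. to_nat s = k \<and> Q s \<and> u n a \<in> cell \<omega> s}"
    have "measure M (?A k) = \<P>(b in N. Q (Z n b) \<and> to_nat (Z n b) = k)" for k
    proof (cases "\<exists>s :: nat \<times> nat. to_nat s = k \<and> Q s")
      case True
      then obtain s :: "nat \<times> nat" where s: "k = to_nat s" "Q s" by auto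
      have "?A k = {a \<in> space M. u n a \<in> cell \<omega> s}" using s by auto
      moreover have "{b \<in> space N. Q (Z n b) \<and> to_nat (Z n b) = k} = {b \<in> space N. Z n b = s}"
        using s by auto
      ultimately show ?thesis using cell_prob[of n s] by simp
    next
      case False
      then have "?A k = {}" "{b \<in> space N. Q (Z n b) \<and> to_nat (Z n b) = k} = {}" by blast+
      then show ?thesis by (simp only: measure_empty)
    qed
    moreover have "(\<lambda>k. \<P>(b in N. Q (Z n b) \<and> to_nat (Z n b) = k)) sums \<P>(b in N. Q (Z n b))"
      by (rule N.prob_sums_countable) auto
    moreover have "(\<lambda>k. measure M (?A k)) sums measure M (\<Union>k. ?A k)"
    proof (rule M.finite_measure_UNION)
      show "disjoint_family ?A"
        unfolding disjoint_family_on_def using cell_unique[OF assms(1)] by blast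
    qed auto
    moreover have "(\<Union>k. ?A k) = {a \<in> space M. \<exists>s. Q s \<and> u n a \<in> cell \<omega> s}" by auto
    ultimately show ?thesis
      by (metis (no_types, lifting) sums_cong sums_unique2)
  qed
  have AE_cell: "AE a in M. \<exists>s. u n a \<in> cell \<omega> s" for n
    using union[of "\<lambda>_. True" n] N.prob_space by (subst M.prob_Collect_eq_1[symmetric]) auto
  have "\<P>(a in M. u n a \<in> {real x..<real x + 1}) = \<P>(b in N. fst (Z n b) = x)" for n x
  proof -
    \<comment> \<open>The equivalence fails at \<open>v = real x\<close>, so it is asserted only on
      cells and then used almost everywhere.\<close>
    have iff: "v \<in> {real x..<real x + 1} \<longleftrightarrow> (\<exists>s. fst s = x \<and> v \<in> cell \<omega> s)" if "v \<in> cell \<omega> t" for v t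
    proof -
      obtain x' y' where t: "t = (x', y')" by (cases t)
      have "v \<in> {real x..<real x + 1} \<longleftrightarrow> \<lfloor>v\<rfloor> = int x"
        by (auto simp: floor_eq_iff)
      also have "\<dots> \<longleftrightarrow> fst t = x"
        using floor_cell(1)[OF assms(1), of v x' y'] that t by simp
      finally show ?thesis
        using that cell_unique[OF assms(1), of v] by blast
    qed
    have "\<P>(a in M. u n a \<in> {real x..<real x + 1}) = \<P>(a in M. \<exists>s. fst s = x \<and> u n a \<in> cell \<omega> s)"
    proof (rule M.prob_eq_AE)
      show "AE a in M. u n a \<in> {real x..<real x + 1} \<longleftrightarrow> (\<exists>s. fst s = x \<and> u n a \<in> cell \<omega> s)"
        using AE_cell by eventually_elim (use iff in blast)
    qed measurable
    then show ?thesis using union[of "\<lambda>s. fst s = x" n] by simp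
  qed
  with cell_prob show ?thesis by blast
qed

end
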